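(* Let $t\ge1$ and let $\ell_1,\dots,\ell_t$ be distinct positive integers. For an integer $n>2t+1$ put $m=n-1$ and let $f_t:\{-1,1\}^m\to\mathbb R$ be $$f_t(\boldsymbol z)=2^{-t}\prod_{j=1}^{t}\bigl(n-4\ell_j-S(\boldsymbol z)-P(\boldsymbol z)\bigr),\qquad S(\boldsymbol z)=\sum_{i=1}^{m}z_i,\quad P(\boldsymbol z)=\prod_{i=1}^{m}z_i .$$ Then there are polynomials $R_{t,s}$ ($0\le s\le t$) and $R'_{t,s}$ ($0\le s\le t-1$) in the variable $n$, whose coefficients depend polynomially on $\ell_1,\dots,\ell_t$, such that for every $n>2t+1$ and every $T\subseteq[m]$ the following hold. (i) If $|T|=s$ with $0\le s\le t$, then $$\widehat f_t(T)=\frac{(-1)^s}{2^t}\,\frac{t!}{(t-s)!}\,n^{t-s}+R_{t,s}(n),$$ where $R_{t,s}$ has degree at most $t-s-1$ in $n$; in particular $R_{t,t}=0$. (ii) If $|T|=m-s$ with $0\le s\le t-1$, then $$\widehat f_t(T)=\frac{(-1)^{s+1}}{2^t}\,\frac{t!}{(t-s-1)!}\,n^{t-1-s}+R'_{t,s}(n),$$ where $R'_{t,s}$ has degree at most $t-s-2$ in $n$; in particular $R'_{t,t-1}=0$. (iii) If $t<|T|<m-t+1$, then $\widehat f_t(T)=0$.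
   Context: $[m]=\{1,\dots,m\}$. For $T\subseteq[m]$ the character $\chi_T:\{-1,1\}^m\to\mathbb R$ is $\chi_T(\boldsymbol z)=\prod_{i\in T}z_i$, and the Fourier coefficient of $h:\{-1,1\}^m\to\mathbb R$ at $T$ is $\widehat h(T)=2^{-m}\sum_{\boldsymbol z\in\{-1,1\}^m}h(\boldsymbol z)\chi_T(\boldsymbol z)$. By convention, any polynomial of negative degree is identically zero. *)

theory Defs
  imports
    Complex_Main
    "HOL-Library.FuncSet"
    "HOL-Library.Poly_Mapping"
    "HOL-Computational_Algebra.Polynomial"
begin

text \<open>
  Points of the cube are functions on the naturals taking the value \<open>undefined\<close> outside
  \<open>{1..m}\<close>, so that the cube has exactly \<open>2 ^ m\<close> elements.
\<close>

definition cube :: "nat \<Rightarrow> (nat \<Rightarrow> real) set" where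
  "cube m = {1..m} \<rightarrow>\<^sub>E {-1, 1}"

definition character :: "nat set \<Rightarrow> (nat \<Rightarrow> real) \<Rightarrow> real" where
  "character T z = (\<Prod>i\<in>T. z i)"

definition fourier_coeff :: "nat \<Rightarrow> ((nat \<Rightarrow> real) \<Rightarrow> real) \<Rightarrow> nat set \<Rightarrow> real" where
  "fourier_coeff m h T = (1 / 2 ^ m) * (\<Sum>z\<in>cube m. h z * character T z)"

definition f_fun :: "nat \<Rightarrow> (nat \<Rightarrow> nat) \<Rightarrow> nat \<Rightarrow> (nat \<Rightarrow> real) \<Rightarrow> real" where
  "f_fun t l n z =
     (1 / 2 ^ t) *
     (\<Prod>j=1..t. real n - 4 * real (l j) - (\<Sum>i=1..n-1. z i) - (\<Prod>i=1..n-1. z i))"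

text \<open>
  Real multivariate polynomials are finitely supported maps from monomials to coefficients,
  a monomial being the finitely supported map of its exponents.  A polynomial in \<open>n\<close> whose
  coefficients are polynomials in \<open>l 1, l 2, \<dots>\<close> has type \<open>real_mpoly poly\<close>.
\<close>

type_synonym real_mpoly = "(nat \<Rightarrow>\<^sub>0 nat) \<Rightarrow>\<^sub>0 real"

definition mpoly_vars :: "real_mpoly \<Rightarrow> nat set" where
  "mpoly_vars p = (\<Union>mon\<in>Poly_Mapping.keys p. Poly_Mapping.keys mon)"

definition mpoly_eval :: "(nat \<Rightarrow> real) \<Rightarrow> real_mpoly \<Rightarrow> real" where
  "mpoly_eval x p =
     (\<Sum>mon\<in>Poly_Mapping.keys p. Poly_Mapping.lookup p mon *
        (\<Prod>i\<in>Poly_Mapping.keys mon. x i ^ Poly_Mapping.lookup mon i))"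

definition coeffs_in_vars :: "nat \<Rightarrow> real_mpoly poly \<Rightarrow> bool" where
  "coeffs_in_vars t R \<longleftrightarrow> (\<forall>k. mpoly_vars (coeff R k) \<subseteq> {1..t})"

definition specialize :: "(nat \<Rightarrow> nat) \<Rightarrow> real_mpoly poly \<Rightarrow> real poly" where
  "specialize l R = map_poly (mpoly_eval (\<lambda>j. real (l j))) R"

text \<open>
  The library gives the zero polynomial degree \<open>0\<close>.  Here the bound is an integer and
  zero satisfies every bound, so a polynomial with a negative bound must be zero.
\<close>

definition degree_at_most :: "'a::zero poly \<Rightarrow> int \<Rightarrow> bool" where
  "degree_at_most p d \<longleftrightarrow> p = 0 \<or> int (degree p) \<le> d"

end

theory Submission
  imports Defs
begin

text \<open>
  Put \<open>y i = z i\<close> for \<open>i \<le> m\<close> and \<open>y n = P\<close>, so that \<open>S + P\<close> is the sum of \<open>n\<close> sign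
  variables. The product defining \<open>f\<close> is then symmetric in the \<open>y i\<close>, that is, a combination
  of the characters of subsets \<open>U\<close> of \<open>{1..n}\<close> whose coefficients \<open>g (card U)\<close> obey a
  recursion in the number of factors and vanish for \<open>card U > t\<close>. On the cube the characters
  of \<open>U\<close> and of its complement agree, so the Fourier coefficient at \<open>T\<close> is
  \<open>g (card T) + g (n - card T)\<close> up to the factor \<open>1 / 2 ^ t\<close>. As \<open>n > 2 * t + 1\<close>, at most one
  summand is nonzero; hence (ii) is (i) with \<open>s + 1\<close> in place of \<open>s\<close>. The leading
  coefficient of \<open>g s\<close> in \<open>n\<close> follows Pascal's rule.
\<close>

section \<open>Evaluation of polynomials\<close>

text \<open>Monomials outside the support have coefficient 0, so polynomials with different supports
  can be summed over one common index set.\<close>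

lemma mpoly_eval_superset:
  assumes "finite S" "Poly_Mapping.keys p \<subseteq> S"
  shows "mpoly_eval x p = (\<Sum>mon\<in>S. Poly_Mapping.lookup p mon *
        (\<Prod>i\<in>Poly_Mapping.keys mon. x i ^ Poly_Mapping.lookup mon i))"
  unfolding mpoly_eval_def
  by (rule sum.mono_neutral_left) (use assms in \<open>auto simp: in_keys_iff\<close>)

lemma monomial_eval_superset:
  fixes x :: "nat \<Rightarrow> real"
  assumes "finite S" "Poly_Mapping.keys a \<subseteq> S"
  shows "(\<Prod>i\<in>Poly_Mapping.keys a. x i ^ Poly_Mapping.lookup a i) = (\<Prod>i\<in>S. x i ^ Poly_Mapping.lookup a i)"
  by (rule prod.mono_neutral_left) (use assms in \<open>auto simp: in_keys_iff\<close>)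

lemma monomial_eval_add:
  fixes x :: "nat \<Rightarrow> real"
  shows "(\<Prod>i\<in>Poly_Mapping.keys (a + b). x i ^ Poly_Mapping.lookup (a + b) i) =
    (\<Prod>i\<in>Poly_Mapping.keys a. x i ^ Poly_Mapping.lookup a i) *
    (\<Prod>i\<in>Poly_Mapping.keys b. x i ^ Poly_Mapping.lookup b i)"
proof -
  define S where "S = Poly_Mapping.keys a \<union> Poly_Mapping.keys b"
  have S: "finite S" "Poly_Mapping.keys a \<subseteq> S" "Poly_Mapping.keys b \<subseteq> S"
    "Poly_Mapping.keys (a + b) \<subseteq> S"
    using Poly_Mapping.keys_add[of a b] by (auto simp: S_def)
  show ?thesis
    unfolding monomial_eval_superset[OF S(1,2)] monomial_eval_superset[OF S(1,3)]
      monomial_eval_superset[OF S(1,4)]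
    by (simp add: prod.distrib lookup_add power_add)
qed

lemma mpoly_eval_zero [simp]: "mpoly_eval x 0 = 0"
  by (simp add: mpoly_eval_def)

lemma mpoly_eval_add: "mpoly_eval x (p + q) = mpoly_eval x p + mpoly_eval x q"
proof -
  define S where "S = Poly_Mapping.keys p \<union> Poly_Mapping.keys q"
  have S: "finite S" "Poly_Mapping.keys p \<subseteq> S" "Poly_Mapping.keys q \<subseteq> S"
    "Poly_Mapping.keys (p + q) \<subseteq> S"
    using Poly_Mapping.keys_add[of p q] by (auto simp: S_def)
  show ?thesis
    using S by (simp add: mpoly_eval_superset[of S] sum.distrib lookup_add algebra_simps)
qed

lemma mpoly_eval_single:
  "mpoly_eval x (Poly_Mapping.single a c) =
    c * (\<Prod>i\<in>Poly_Mapping.keys a. x i ^ Poly_Mapping.lookup a i)"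
  by (simp add: mpoly_eval_def)

text \<open>Turns the step of \<open>update_induct\<close> into an addition, so that
  multiplicativity of evaluation can be proved one term at a time.\<close>

lemma update_eq_add_single:
  fixes f :: "'a \<Rightarrow>\<^sub>0 'b::comm_monoid_add"
  assumes "a \<notin> Poly_Mapping.keys f"
  shows "Poly_Mapping.update a b f = f + Poly_Mapping.single a b"
  using assms
  by (intro poly_mapping_eqI) (auto simp: lookup_update lookup_add lookup_single in_keys_iff when_def)

lemma mpoly_eval_single_mult:
  "mpoly_eval x (Poly_Mapping.single a c * q) =
    mpoly_eval x (Poly_Mapping.single a c) * mpoly_eval x q"
proof (induction q rule: update_induct)
  case (update f b d)
  then show ?case
    by (simp add: update_eq_add_single distrib_left mpoly_eval_add mult_single
        mpoly_eval_single monomial_eval_add)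
qed simp

lemma mpoly_eval_mult: "mpoly_eval x (p * q) = mpoly_eval x p * mpoly_eval x q"
proof (induction p rule: update_induct)
  case (update f b d)
  then show ?case
    by (simp add: update_eq_add_single distrib_right mpoly_eval_add mpoly_eval_single_mult)
qed simp

section \<open>Variables occurring in a polynomial\<close>

lemma mpoly_vars_add: "mpoly_vars (p + q) \<subseteq> mpoly_vars p \<union> mpoly_vars q"
  using Poly_Mapping.keys_add[of p q] by (auto simp: mpoly_vars_def)

lemma mpoly_vars_mult: "mpoly_vars (p * q) \<subseteq> mpoly_vars p \<union> mpoly_vars q"
proof
  fix i assume "i \<in> mpoly_vars (p * q)"
  then obtain mon where mon: "mon \<in> Poly_Mapping.keys (p * q)" "i \<in> Poly_Mapping.keys mon"
    by (auto simp: mpoly_vars_def)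
  then obtain a b where "mon = a + b" "a \<in> Poly_Mapping.keys p" "b \<in> Poly_Mapping.keys q"
    using Poly_Mapping.keys_mult[of p q] by blast
  then show "i \<in> mpoly_vars p \<union> mpoly_vars q"
    using mon(2) Poly_Mapping.keys_add[of a b] by (auto simp: mpoly_vars_def)
qed

lemma mpoly_vars_uminus [simp]: "mpoly_vars (- p) = mpoly_vars p"
  by (simp add: mpoly_vars_def)

lemma mpoly_vars_sum:
  assumes "\<And>i. i \<in> A \<Longrightarrow> mpoly_vars (f i) \<subseteq> V"
  shows "mpoly_vars (sum f A) \<subseteq> V"
  using assms
proof (induction A rule: infinite_finite_induct)
  case (insert a A)
  then show ?case
    using mpoly_vars_add[of "f a" "sum f A"] by (simp add: subset_iff) blast
qed (auto simp: mpoly_vars_def)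

lemma coeffs_in_vars_add:
  "coeffs_in_vars t p \<Longrightarrow> coeffs_in_vars t q \<Longrightarrow> coeffs_in_vars t (p + q)"
  unfolding coeffs_in_vars_def coeff_add using mpoly_vars_add by blast

lemma coeffs_in_vars_diff:
  "coeffs_in_vars t p \<Longrightarrow> coeffs_in_vars t q \<Longrightarrow> coeffs_in_vars t (p - q)"
  using coeffs_in_vars_add[of t p "- q"] by (simp add: coeffs_in_vars_def)

lemma coeffs_in_vars_mult:
  assumes "coeffs_in_vars t p" "coeffs_in_vars t q"
  shows "coeffs_in_vars t (p * q)"
  unfolding coeffs_in_vars_def coeff_mult
proof (intro allI mpoly_vars_sum)
  fix k i
  show "mpoly_vars (coeff p i * coeff q (k - i)) \<subseteq> {1..t}"
    using assms mpoly_vars_mult[of "coeff p i" "coeff q (k - i)"]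
    unfolding coeffs_in_vars_def by blast
qed

lemma coeffs_in_vars_zero: "coeffs_in_vars t 0"
  by (simp add: coeffs_in_vars_def mpoly_vars_def)

lemma coeffs_in_vars_pCons:
  "mpoly_vars c \<subseteq> {1..t} \<Longrightarrow> coeffs_in_vars t p \<Longrightarrow> coeffs_in_vars t (pCons c p)"
  by (auto simp: coeffs_in_vars_def coeff_pCons split: nat.splits)

lemma mpoly_vars_single_0 [simp]: "mpoly_vars (Poly_Mapping.single 0 c) = {}"
  by (simp add: mpoly_vars_def)

lemma mpoly_eval_single_0 [simp]: "mpoly_eval x (Poly_Mapping.single 0 c) = c"
  by (simp add: mpoly_eval_single)

section \<open>Specialization of the variables as a ring homomorphism\<close>

lemma mpoly_eval_uminus: "mpoly_eval x (- p) = - mpoly_eval x p"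
  using mpoly_eval_add[of x p "- p"] by simp

lemma specialize_add: "specialize l (p + q) = specialize l p + specialize l q"
  by (intro poly_eqI) (simp add: specialize_def coeff_map_poly mpoly_eval_add)

lemma specialize_uminus: "specialize l (- p) = - specialize l p"
  by (intro poly_eqI) (simp add: specialize_def coeff_map_poly mpoly_eval_uminus)

lemma specialize_diff: "specialize l (p - q) = specialize l p - specialize l q"
  using specialize_add[of l p "- q"] by (simp add: specialize_uminus)

lemma mpoly_eval_sum: "mpoly_eval x (sum f A) = (\<Sum>i\<in>A. mpoly_eval x (f i))"
  by (induction A rule: infinite_finite_induct) (simp_all add: mpoly_eval_add)

lemma specialize_mult: "specialize l (p * q) = specialize l p * specialize l q"
  by (intro poly_eqI)
    (simp add: specialize_def coeff_map_poly coeff_mult mpoly_eval_sum mpoly_eval_mult)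

lemma specialize_zero [simp]: "specialize l 0 = 0"
  by (simp add: specialize_def)

lemma specialize_pCons:
  "specialize l (pCons c p) = pCons (mpoly_eval (\<lambda>j. real (l j)) c) (specialize l p)"
  by (simp add: specialize_def map_poly_pCons)

section \<open>Multiplication by a sum of sign variables\<close>

text \<open>
  Multiplying a symmetric combination of characters of \<open>N\<close> sign variables by
  \<open>N - a k - \<Sum>i. y i\<close> gives a symmetric combination again, since \<open>y i\<close> times the character
  of \<open>U\<close> is the character of \<open>U\<close> with \<open>i\<close> added or removed. A set of size \<open>s\<close> arises from
  \<open>s\<close> sets of size \<open>s - 1\<close> and \<open>N - s\<close> sets of size \<open>s + 1\<close>.
\<close>

fun sym_coeff :: "'a::comm_ring_1 \<Rightarrow> (nat \<Rightarrow> 'a) \<Rightarrow> nat \<Rightarrow> nat \<Rightarrow> 'a" where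
  "sym_coeff N a 0 s = of_bool (s = 0)"
| "sym_coeff N a (Suc k) s = (N - a (Suc k)) * sym_coeff N a k s
     - of_nat s * sym_coeff N a k (s - 1) - (N - of_nat s) * sym_coeff N a k (Suc s)"

text \<open>One more factor enlarges a set by at most one element: for \<open>s > Suc k\<close> the
  indices \<open>s\<close>, \<open>s - 1\<close> and \<open>Suc s\<close> in the recursion all
  exceed \<open>k\<close>.\<close>

lemma sym_coeff_eq_0: "k < s \<Longrightarrow> sym_coeff N a k s = 0"
  by (induction k arbitrary: s) auto

text \<open>The recursion uses ring operations only, so it commutes with ring homomorphisms. This
  links its polynomial version with its real values.\<close>

lemma sym_coeff_hom:
  fixes h :: "'a::comm_ring_1 \<Rightarrow> 'b::comm_ring_1"
  assumes one: "h 1 = 1" and diff: "\<And>x y. h (x - y) = h x - h y"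
    and mult: "\<And>x y. h (x * y) = h x * h y"
  shows "h (sym_coeff N a k s) = sym_coeff (h N) (\<lambda>j. h (a j)) k s"
proof -
  have zero: "h 0 = 0" using diff[of 0 0] by simp
  have add: "h (x + y) = h x + h y" for x y
    using diff[of x "- y"] diff[of 0 y] by (simp add: zero)
  have of_nat: "h (of_nat i) = of_nat i" for i
    by (induction i) (simp_all add: zero one add)
  show ?thesis
    by (induction k arbitrary: s) (simp_all add: zero one diff mult of_nat)
qed

text \<open>\<open>sym_diff W {i}\<close> removes \<open>i\<close> if \<open>i\<close> lies in
  \<open>W\<close> and adds it otherwise. For empty \<open>W\<close> the truncated
  \<open>card W - 1\<close> is harmless, as its factor is 0.\<close>

lemma sum_card_sym_diff_singleton:
  fixes c :: "nat \<Rightarrow> real"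
  assumes "finite I" "W \<subseteq> I"
  shows "(\<Sum>i\<in>I. c (card (sym_diff W {i}))) =
    real (card W) * c (card W - 1) + (real (card I) - real (card W)) * c (Suc (card W))"
proof -
  have fW: "finite W" using assms finite_subset by blast
  have "(\<Sum>i\<in>I. c (card (sym_diff W {i}))) =
      (\<Sum>i\<in>I - W. c (card (sym_diff W {i}))) + (\<Sum>i\<in>W. c (card (sym_diff W {i})))"
    by (rule sum.subset_diff) (use assms in auto)
  also have "(\<Sum>i\<in>I - W. c (card (sym_diff W {i}))) = (\<Sum>i\<in>I - W. c (Suc (card W)))"
  proof (rule sum.cong)
    fix i assume "i \<in> I - W"
    then have "sym_diff W {i} = insert i W" "i \<notin> W" by auto
    then show "c (card (sym_diff W {i})) = c (Suc (card W))" using fW by simp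
  qed simp
  also have "(\<Sum>i\<in>W. c (card (sym_diff W {i}))) = (\<Sum>i\<in>W. c (card W - 1))"
  proof (rule sum.cong)
    fix i assume "i \<in> W"
    then have "sym_diff W {i} = W - {i}" by auto
    then show "c (card (sym_diff W {i})) = c (card W - 1)" using fW \<open>i \<in> W\<close> by simp
  qed simp
  finally show ?thesis
    using assms fW by (simp add: card_Diff_subset of_nat_diff card_mono)
qed

text \<open>Both characters contain the factor of \<open>A \<inter> B\<close>, whose square is
  1.\<close>

lemma character_mult:
  assumes "finite A" "finite B" "\<And>i. i \<in> A \<inter> B \<Longrightarrow> y i * y i = 1"
  shows "character A y * character B y = character (sym_diff A B) y"
proof -
  have A: "character A y = character (A - B) y * character (A \<inter> B) y"
    unfolding character_def using assms(1)
    by (subst prod.union_disjoint[symmetric]) (auto intro: arg_cong[of _ _ "prod y"])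
  have B: "character B y = character (B - A) y * character (A \<inter> B) y"
    unfolding character_def using assms(2)
    by (subst prod.union_disjoint[symmetric]) (auto intro: arg_cong[of _ _ "prod y"])
  have "character (A \<inter> B) y * character (A \<inter> B) y = 1"
    unfolding character_def prod.distrib[symmetric] using assms(3) by simp
  then have "character A y * character B y = character (A - B) y * character (B - A) y"
    unfolding A B by (simp add: mult.assoc mult.left_commute)
  also have "\<dots> = character (sym_diff A B) y"
    unfolding character_def using assms by (subst prod.union_disjoint) auto
  finally show ?thesis .
qed

lemma sum_mult_sum_character:
  fixes c :: "nat \<Rightarrow> real"
  assumes I: "finite I" and y: "\<And>i. i \<in> I \<Longrightarrow> y i * y i = 1"
  shows "(\<Sum>i\<in>I. y i) * (\<Sum>U\<in>Pow I. c (card U) * character U y) =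
    (\<Sum>W\<in>Pow I. (real (card W) * c (card W - 1) +
       (real (card I) - real (card W)) * c (Suc (card W))) * character W y)"
proof -
  have "(\<Sum>U\<in>Pow I. y i * (c (card U) * character U y)) =
      (\<Sum>W\<in>Pow I. c (card (sym_diff W {i})) * character W y)" if i: "i \<in> I" for i
  \<comment> \<open>Toggling \<open>i\<close> is an involution on \<open>Pow I\<close>, hence its
    own inverse in the reindexing.\<close>
  proof (rule sum.reindex_bij_witness[of _ "\<lambda>W. sym_diff W {i}" "\<lambda>U. sym_diff U {i}"])
    fix U assume U: "U \<in> Pow I"
    then have "finite U" using I finite_subset by blast
    then have "character U y * character {i} y = character (sym_diff U {i}) y"
      using i y by (intro character_mult) auto
    moreover have "sym_diff (sym_diff U {i}) {i} = U" by auto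
    ultimately show "c (card (sym_diff (sym_diff U {i}) {i})) * character (sym_diff U {i}) y =
        y i * (c (card U) * character U y)"
      by (simp only:) (simp add: character_def mult_ac)
  qed (use i in auto)
  then have "(\<Sum>i\<in>I. y i) * (\<Sum>U\<in>Pow I. c (card U) * character U y) =
      (\<Sum>i\<in>I. \<Sum>W\<in>Pow I. c (card (sym_diff W {i})) * character W y)"
    unfolding sum_distrib_right by (subst (1) sum_distrib_left) simp
  also have "\<dots> = (\<Sum>W\<in>Pow I. (\<Sum>i\<in>I. c (card (sym_diff W {i}))) * character W y)"
    by (subst sum.swap) (simp add: sum_distrib_right)
  also have "\<dots> = (\<Sum>W\<in>Pow I. (real (card W) * c (card W - 1) +
       (real (card I) - real (card W)) * c (Suc (card W))) * character W y)"
    by (rule sum.cong) (use I in \<open>auto simp: sum_card_sym_diff_singleton\<close>)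
  finally show ?thesis .
qed

lemma prod_eq_sum_character:
  fixes a :: "nat \<Rightarrow> real"
  assumes I: "finite I" and y: "\<And>i. i \<in> I \<Longrightarrow> y i * y i = 1"
  shows "(\<Prod>j=1..k. real (card I) - a j - (\<Sum>i\<in>I. y i)) =
    (\<Sum>U\<in>Pow I. sym_coeff (real (card I)) a k (card U) * character U y)"
proof (induction k)
  case 0
  have "(\<Sum>U\<in>Pow I. of_bool (card U = 0) * character U y) =
      (\<Sum>U\<in>{{}}. of_bool (card U = 0) * character U y)"
    by (rule sum.mono_neutral_right) (use I in \<open>auto simp: rev_finite_subset\<close>)
  then show ?case by (simp add: character_def)
next
  case (Suc k)
  define g where "g = sym_coeff (real (card I)) a k"
  have "(\<Prod>j=1..Suc k. real (card I) - a j - (\<Sum>i\<in>I. y i)) =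
      (real (card I) - a (Suc k) - (\<Sum>i\<in>I. y i)) * (\<Sum>U\<in>Pow I. g (card U) * character U y)"
    using Suc by (simp add: mult.commute g_def)
  also have "\<dots> = (real (card I) - a (Suc k)) * (\<Sum>U\<in>Pow I. g (card U) * character U y) -
      (\<Sum>W\<in>Pow I. (real (card W) * g (card W - 1) +
       (real (card I) - real (card W)) * g (Suc (card W))) * character W y)"
    using sum_mult_sum_character[OF I y, where c = g] by (simp add: left_diff_distrib)
  also have "\<dots> = (\<Sum>U\<in>Pow I. sym_coeff (real (card I)) a (Suc k) (card U) * character U y)"
    unfolding sum_distrib_left sum_subtractf[symmetric]
    by (rule sum.cong) (simp_all add: g_def algebra_simps)
  finally show ?case .
qed

section \<open>Fourier coefficients\<close>

text \<open>The sum factors over the coordinates: one in \<open>A\<close> contributes -1 + 1 = 0,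
  any other contributes 2.\<close>

lemma sum_cube_character:
  assumes "A \<subseteq> {1..m}"
  shows "(\<Sum>z\<in>cube m. character A z) = (if A = {} then 2 ^ m else 0)"
proof -
  have "(\<Sum>z\<in>cube m. character A z) =
      (\<Sum>z\<in>cube m. \<Prod>i\<in>{1..m}. if i \<in> A then z i else 1)"
  proof (rule sum.cong)
    fix z :: "nat \<Rightarrow> real"
    have "{1..m} \<inter> {i. i \<in> A} = A" using assms by auto
    then show "character A z = (\<Prod>i\<in>{1..m}. if i \<in> A then z i else 1)"
      by (simp add: character_def prod.If_cases)
  qed simp
  also have "\<dots> = (\<Prod>i\<in>{1..m}. \<Sum>x\<in>{-1, 1::real}. if i \<in> A then x else 1)"
    unfolding cube_def
    by (rule prod_sum_PiE[of "{1..m}" "\<lambda>i. {-1, 1::real}" "\<lambda>i x. if i \<in> A then x else 1", symmetric])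
      auto
  also have "\<dots> = (\<Prod>i\<in>{1..m}. if i \<in> A then 0 else 2)"
    by (rule prod.cong) auto
  also have "\<dots> = (if A = {} then 2 ^ m else 0)"
    using assms by (auto simp: prod_zero_iff)
  finally show ?thesis .
qed

text \<open>
  Adjoining the product \<open>P\<close> as a further sign variable identifies the characters of a set
  and of its complement in \<open>{1..Suc m}\<close>.
\<close>

definition extend_sign :: "nat \<Rightarrow> (nat \<Rightarrow> real) \<Rightarrow> nat \<Rightarrow> real" where
  "extend_sign m z = z(Suc m := (\<Prod>i=1..m. z i))"

lemma cube_square: "z \<in> cube m \<Longrightarrow> i \<in> {1..m} \<Longrightarrow> z i * z i = 1"
  using PiE_mem[of z "{1..m}" "\<lambda>_. {-1, 1}" i] by (auto simp: cube_def)

lemma extend_sign_square: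
  assumes "z \<in> cube m" "i \<in> {1..Suc m}"
  shows "extend_sign m z i * extend_sign m z i = 1"
proof (cases "i = Suc m")
  case True
  then show ?thesis
    using assms cube_square[of z m] by (simp add: extend_sign_def flip: prod.distrib)
next
  case False
  then show ?thesis
    using assms cube_square[of z m i] by (simp add: extend_sign_def)
qed

lemma character_extend_sign:
  assumes "A \<subseteq> {1..m}"
  shows "character A (extend_sign m z) = character A z"
  unfolding character_def extend_sign_def by (rule prod.cong) (use assms in auto)

text \<open>If \<open>Suc m\<close> lies in \<open>W\<close>, its coordinate is the character of
  \<open>{1..m}\<close>, which turns the rest of \<open>W\<close> into its complement in
  \<open>{1..m}\<close>. That complement is empty exactly when \<open>W\<close> is the full
  set.\<close>

lemma sum_cube_character_extend_sign:
  assumes "W \<subseteq> {1..Suc m}"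
  shows "(\<Sum>z\<in>cube m. character W (extend_sign m z)) =
    (if W = {} \<or> W = {1..Suc m} then 2 ^ m else 0)"
proof (cases "Suc m \<in> W")
  case False
  then have W: "W \<subseteq> {1..m}" using assms by (auto simp: le_Suc_eq subset_iff)
  then show ?thesis
    using sum_cube_character[OF W] False by (auto simp: character_extend_sign)
next
  case True
  define V where "V = W - {Suc m}"
  have V: "V \<subseteq> {1..m}" "finite V"
    using assms finite_subset[OF assms] by (auto simp: V_def le_Suc_eq subset_iff)
  have W: "W = insert (Suc m) V" "Suc m \<notin> V" using True by (auto simp: V_def)
  have D: "sym_diff {1..m} V = {1..m} - V" using V by auto
  have "character W (extend_sign m z) = character ({1..m} - V) z" if "z \<in> cube m" for z
  proof -
    have "character W (extend_sign m z) = character {1..m} z * character V z"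
      using V W character_extend_sign[OF V(1), of z]
      by (simp add: character_def extend_sign_def)
    also have "\<dots> = character (sym_diff {1..m} V) z"
      using V that cube_square by (intro character_mult) auto
    finally show ?thesis by (simp only: D)
  qed
  then have "(\<Sum>z\<in>cube m. character W (extend_sign m z)) =
      (if {1..m} - V = {} then 2 ^ m else 0)"
    by (simp add: sum_cube_character)
  also have "{1..m} - V = {} \<longleftrightarrow> W = {1..Suc m}"
    using V W by (auto simp: atLeastAtMostSuc_conv insert_ident)
  finally show ?thesis using True by auto
qed

text \<open>After multiplication by the character of \<open>T\<close>, orthogonality leaves only the
  sets \<open>U\<close> for which \<open>sym_diff U T\<close> is empty or full, namely
  \<open>T\<close> and its complement in \<open>{1..Suc m}\<close>.\<close>

lemma fourier_coeff_f_fun: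
  assumes T: "T \<subseteq> {1..m}"
  shows "fourier_coeff m (f_fun t l (Suc m)) T = 1 / 2 ^ t *
    (sym_coeff (real (Suc m)) (\<lambda>j. 4 * real (l j)) t (card T) +
     sym_coeff (real (Suc m)) (\<lambda>j. 4 * real (l j)) t (Suc m - card T))"
proof -
  let ?I = "{1..Suc m}"
  let ?g = "sym_coeff (real (Suc m)) (\<lambda>j. 4 * real (l j)) t"
  have T': "T \<subseteq> ?I" "finite T" using T by (auto intro: finite_subset)
  have f: "f_fun t l (Suc m) z * character T z =
      1 / 2 ^ t * (\<Sum>U\<in>Pow ?I. ?g (card U) * character (sym_diff U T) (extend_sign m z))"
    if z: "z \<in> cube m" for z
  proof -
    let ?y = "extend_sign m z"
    have "(\<Sum>i=1..m. ?y i) = (\<Sum>i=1..m. z i)"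
      by (rule sum.cong) (auto simp: extend_sign_def)
    then have "(\<Sum>i\<in>?I. ?y i) = (\<Sum>i=1..m. z i) + (\<Prod>i=1..m. z i)"
      by (simp add: extend_sign_def)
    then have "f_fun t l (Suc m) z =
        1 / 2 ^ t * (\<Prod>j=1..t. real (card ?I) - 4 * real (l j) - (\<Sum>i\<in>?I. ?y i))"
      by (simp add: f_fun_def algebra_simps)
    also have "\<dots> = 1 / 2 ^ t * (\<Sum>U\<in>Pow ?I. ?g (card U) * character U ?y)"
      using prod_eq_sum_character[of ?I ?y "\<lambda>j. 4 * real (l j)" t] extend_sign_square[OF z]
      by simp
    finally have "f_fun t l (Suc m) z * character T z =
        1 / 2 ^ t * (\<Sum>U\<in>Pow ?I. ?g (card U) * (character U ?y * character T ?y))"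
      using character_extend_sign[OF T, of z] by (simp add: sum_distrib_right mult.assoc)
    also have "(\<Sum>U\<in>Pow ?I. ?g (card U) * (character U ?y * character T ?y)) =
        (\<Sum>U\<in>Pow ?I. ?g (card U) * character (sym_diff U T) ?y)"
    proof (rule sum.cong)
      fix U assume "U \<in> Pow ?I"
      then have "character U ?y * character T ?y = character (sym_diff U T) ?y"
        using T' extend_sign_square[OF z] by (intro character_mult) (auto intro: finite_subset)
      then show "?g (card U) * (character U ?y * character T ?y) =
          ?g (card U) * character (sym_diff U T) ?y" by simp
    qed simp
    finally show ?thesis .
  qed
  \<comment> \<open>Only the complement contains \<open>Suc m\<close>, so the two surviving sets are
    distinct and give two summands.\<close>
  have ne: "T \<noteq> ?I - T" using T by force
  have orth: "(\<Sum>z\<in>cube m. character (sym_diff U T) (extend_sign m z)) =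
      (if U \<in> {T, ?I - T} then 2 ^ m else 0)" if "U \<in> Pow ?I" for U
  proof -
    have "sym_diff U T \<subseteq> ?I" using that T' by auto
    moreover have "sym_diff U T = {} \<or> sym_diff U T = ?I \<longleftrightarrow> U \<in> {T, ?I - T}"
      using that T' by auto
    ultimately show ?thesis by (simp only: sum_cube_character_extend_sign)
  qed
  have "(\<Sum>z\<in>cube m. f_fun t l (Suc m) z * character T z) = 1 / 2 ^ t *
      (\<Sum>z\<in>cube m. \<Sum>U\<in>Pow ?I. ?g (card U) * character (sym_diff U T) (extend_sign m z))"
    unfolding sum_distrib_left[symmetric] by (simp only: f sum_distrib_left cong: sum.cong)
  also have "\<dots> = 1 / 2 ^ t *
      (\<Sum>U\<in>Pow ?I. ?g (card U) * (\<Sum>z\<in>cube m. character (sym_diff U T) (extend_sign m z)))"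
    by (subst sum.swap) (simp only: sum_distrib_left)
  also have "(\<Sum>U\<in>Pow ?I. ?g (card U) *
        (\<Sum>z\<in>cube m. character (sym_diff U T) (extend_sign m z))) =
      (\<Sum>U\<in>Pow ?I. ?g (card U) * (if U \<in> {T, ?I - T} then 2 ^ m else 0))"
    by (simp only: orth cong: sum.cong)
  also have "\<dots> = (\<Sum>U\<in>{T, ?I - T}. ?g (card U) * 2 ^ m)"
    by (rule sum.mono_neutral_cong_right) (use T' in auto)
  also have "\<dots> = (?g (card T) + ?g (Suc m - card T)) * 2 ^ m"
    using ne T' by (simp add: card_Diff_subset distrib_right)
  finally show ?thesis by (simp add: fourier_coeff_def)
qed

section \<open>The coefficients as polynomials\<close>

text \<open>Running the recursion over the polynomial ring gives one polynomial valid for all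
  \<open>n\<close> and \<open>l\<close>, as the order of quantifiers in the theorem demands.\<close>

definition coeff_poly :: "nat \<Rightarrow> nat \<Rightarrow> real_mpoly poly" where
  "coeff_poly = sym_coeff [:0, 1:]
     (\<lambda>j. [:Poly_Mapping.single (Poly_Mapping.single j 1) 4:])"

lemma poly_specialize_coeff_poly:
  "poly (specialize l (coeff_poly k s)) (real n) =
    sym_coeff (real n) (\<lambda>j. 4 * real (l j)) k s"
proof -
  have one: "mpoly_eval x 1 = 1" for x
    using mpoly_eval_single_0[of x 1] by simp
  show ?thesis
    unfolding coeff_poly_def
    by (subst sym_coeff_hom[of "\<lambda>p. poly (specialize l p) (real n)"])
      (simp_all add: specialize_diff specialize_mult specialize_pCons one one_pCons
        mpoly_eval_single)
qed

lemma coeffs_in_vars_of_nat: "coeffs_in_vars t (of_nat i)"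
  unfolding of_nat_poly
  by (intro coeffs_in_vars_pCons coeffs_in_vars_zero) (simp flip: single_of_nat)

lemma coeffs_in_vars_coeff_poly: "k \<le> t \<Longrightarrow> coeffs_in_vars t (coeff_poly k s)"
proof (induction k arbitrary: s)
  case 0
  show ?case
    using coeffs_in_vars_of_nat[of t "of_bool (s = 0)"] by (simp add: coeff_poly_def)
next
  case (Suc k)
  have "mpoly_vars 1 = {}" by (metis mpoly_vars_single_0 single_one)
  then have "coeffs_in_vars t [:0, 1:]"
    by (intro coeffs_in_vars_pCons coeffs_in_vars_zero) (auto simp: mpoly_vars_def)
  moreover have "coeffs_in_vars t [:Poly_Mapping.single (Poly_Mapping.single (Suc k) 1) 4:]"
    using Suc.prems by (intro coeffs_in_vars_pCons coeffs_in_vars_zero) (auto simp: mpoly_vars_def)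
  ultimately show ?case
    using Suc unfolding coeff_poly_def sym_coeff.simps
    by (intro coeffs_in_vars_diff coeffs_in_vars_mult coeffs_in_vars_of_nat) auto
qed

section \<open>The leading coefficient in \<open>n\<close>\<close>

text \<open>The signed falling factorial of \<open>k\<close> of length \<open>s\<close>. The
  binomial form makes it 0 for \<open>s > k\<close>; integer values embed both in the reals and in
  \<open>real_mpoly\<close>.\<close>

definition top_coeff :: "nat \<Rightarrow> nat \<Rightarrow> int" where
  "top_coeff k s = (-1) ^ s * int ((k choose s) * fact s)"

text \<open>Pascal's rule multiplied by \<open>fact s\<close>, with the sign absorbed.\<close>

lemma top_coeff_Suc: "top_coeff (Suc k) s = top_coeff k s - int s * top_coeff k (s - 1)"
  by (cases s) (simp_all add: top_coeff_def algebra_simps)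

lemma top_coeff_eq:
  "s \<le> k \<Longrightarrow> real_of_int (top_coeff k s) = (-1) ^ s * (fact k / fact (k - s))"
  by (simp add: top_coeff_def binomial_fact)

lemma top_coeff_eq_0: "k < s \<Longrightarrow> top_coeff k s = 0"
  by (simp add: top_coeff_def)

lemma coeff_poly_eq_0: "k < s \<Longrightarrow> coeff_poly k s = 0"
  by (simp add: coeff_poly_def sym_coeff_eq_0)

text \<open>Multiplication by the variable \<open>n\<close> is written as \<open>pCons 0\<close>, a
  shift of the coefficients.\<close>

lemma coeff_poly_Suc:
  "coeff_poly (Suc k) s = pCons 0 (coeff_poly k s)
     - smult (Poly_Mapping.single (Poly_Mapping.single (Suc k) 1) 4) (coeff_poly k s)
     - smult (of_nat s) (coeff_poly k (s - 1))
     - pCons 0 (coeff_poly k (Suc s)) + smult (of_nat s) (coeff_poly k (Suc s))"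
proof -
  have "coeff_poly (Suc k) s =
      ([:0, 1:] - [:Poly_Mapping.single (Poly_Mapping.single (Suc k) 1) 4:]) * coeff_poly k s
      - [:of_nat s:] * coeff_poly k (s - 1) - ([:0, 1:] - [:of_nat s:]) * coeff_poly k (Suc s)"
    by (simp only: coeff_poly_def sym_coeff.simps of_nat_poly)
  then show ?thesis by (simp only: left_diff_distrib) simp
qed

text \<open>In the recursion only \<open>n\<close> times the polynomial at \<open>s\<close> and
  \<open>s\<close> times the one at \<open>s - 1\<close> reach degree \<open>Suc k - s\<close>; the
  terms with \<open>l\<close> and with \<open>Suc s\<close> stay below. Writing \<open>i + s\<close>
  avoids truncated subtraction.\<close>

lemma coeff_coeff_poly:
  "k \<le> i + s \<Longrightarrow> coeff (coeff_poly k s) i = (if i + s = k then of_int (top_coeff k s) else 0)"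
proof (induction k arbitrary: s i)
  case 0
  then show ?case
    by (auto simp: coeff_poly_def top_coeff_def)
next
  case (Suc k)
  \<comment> \<open>For \<open>s = 0\<close> the index \<open>s - 1\<close> truncates to 0, but the
    factor \<open>of_nat s\<close> kills the term.\<close>
  have "of_nat s * coeff (coeff_poly k (s - 1)) i =
      (if i + s = Suc k then of_int (int s * top_coeff k (s - 1)) else 0)"
    using Suc.prems Suc.IH[of i "s - 1"] by (cases s) auto
  then show ?case
    using Suc.prems Suc.IH[of i s] Suc.IH[of i "Suc s"]
      Suc.IH[of "i - 1" s] Suc.IH[of "i - 1" "Suc s"]
    by (cases i) (auto simp: coeff_poly_Suc top_coeff_Suc coeff_poly_eq_0 top_coeff_eq_0)
qed

section \<open>The remainder after the leading term\<close>

definition remainder_poly :: "nat \<Rightarrow> nat \<Rightarrow> real_mpoly poly" where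
  "remainder_poly t s = [:Poly_Mapping.single 0 (1 / 2 ^ t):] *
     (coeff_poly t s - monom (of_int (top_coeff t s)) (t - s))"

lemma coeffs_in_vars_remainder_poly: "coeffs_in_vars t (remainder_poly t s)"
proof -
  have "coeffs_in_vars t (monom (of_int (top_coeff t s)) (t - s))"
    by (auto simp: coeffs_in_vars_def coeff_monom mpoly_vars_def simp flip: single_of_int)
  then show ?thesis
    unfolding remainder_poly_def
    by (intro coeffs_in_vars_mult coeffs_in_vars_diff coeffs_in_vars_coeff_poly
        coeffs_in_vars_pCons coeffs_in_vars_zero) auto
qed

text \<open>Subtracting the top monomial cancels the coefficient at \<open>t - s\<close>, and all
  higher ones are already 0.\<close>

lemma degree_remainder_poly:
  assumes "s \<le> t"
  shows "degree_at_most (remainder_poly t s) (int t - int s - 1)"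
proof (cases "remainder_poly t s = 0")
  case False
  have "coeff (remainder_poly t s) i = 0" if "t \<le> i + s" for i
    using that assms by (auto simp: remainder_poly_def coeff_coeff_poly)
  then have "\<not> t \<le> degree (remainder_poly t s) + s"
    using False leading_coeff_0_iff by blast
  then show ?thesis unfolding degree_at_most_def by linarith
qed (simp add: degree_at_most_def)

lemma poly_specialize_remainder_poly:
  assumes "s \<le> t"
  shows "1 / 2 ^ t * sym_coeff (real n) (\<lambda>j. 4 * real (l j)) t s =
    (-1) ^ s / 2 ^ t * (fact t / fact (t - s)) * real n ^ (t - s)
      + poly (specialize l (remainder_poly t s)) (real n)"
proof -
  let ?e = "mpoly_eval (\<lambda>j. real (l j))"
  have monom: "specialize l (monom c d) = monom (?e c) d" for c d
    by (induction d) (simp_all add: monom_0 monom_Suc specialize_pCons)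
  have of_int: "?e (of_int i) = of_int i" for i
    by (metis mpoly_eval_single_0 single_of_int)
  have "poly (specialize l (remainder_poly t s)) (real n) = 1 / 2 ^ t *
      (sym_coeff (real n) (\<lambda>j. 4 * real (l j)) t s - of_int (top_coeff t s) * real n ^ (t - s))"
    unfolding remainder_poly_def specialize_mult specialize_diff specialize_pCons monom of_int
      poly_mult poly_diff poly_specialize_coeff_poly
    by (simp add: poly_monom)
  then show ?thesis
    unfolding top_coeff_eq[OF assms] by (simp add: algebra_simps)
qed

theorem theorem3p3:
  fixes t :: nat
  assumes "t \<ge> 1"
  shows "\<exists>(R :: nat \<Rightarrow> real_mpoly poly) (R' :: nat \<Rightarrow> real_mpoly poly).
    (\<forall>s\<le>t. coeffs_in_vars t (R s) \<and> degree_at_most (R s) (int t - int s - 1)) \<and>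
    R t = 0 \<and>
    (\<forall>s\<le>t-1. coeffs_in_vars t (R' s) \<and> degree_at_most (R' s) (int t - int s - 2)) \<and>
    R' (t-1) = 0 \<and>
    (\<forall>l :: nat \<Rightarrow> nat. inj_on l {1..t} \<and> (\<forall>j\<in>{1..t}. l j > 0) \<longrightarrow>
      (\<forall>n>2*t+1. \<forall>T\<subseteq>{1..n-1}. let m = n - 1 in
        (\<forall>s\<le>t. card T = s \<longrightarrow>
          fourier_coeff m (f_fun t l n) T =
            (-1) ^ s / 2 ^ t * (fact t / fact (t-s)) * real n ^ (t-s)
            + poly (specialize l (R s)) (real n)) \<and>
        (\<forall>s\<le>t-1. card T = m - s \<longrightarrow>
          fourier_coeff m (f_fun t l n) T =
            (-1) ^ (s+1) / 2 ^ t * (fact t / fact (t-s-1)) * real n ^ (t-1-s)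
            + poly (specialize l (R' s)) (real n)) \<and>
        (t < card T \<and> card T < m - t + 1 \<longrightarrow>
          fourier_coeff m (f_fun t l n) T = 0)))"
\<comment> \<open>A set of size \<open>m - s\<close> has a complement of size \<open>Suc s\<close>
  in \<open>{1..n}\<close>, hence the shifted index in the second witness.\<close>
proof (rule exI[of _ "remainder_poly t"], rule exI[of _ "\<lambda>s. remainder_poly t (Suc s)"],
    intro conjI allI impI)
  show "remainder_poly t t = 0"
    \<comment> \<open>For \<open>s = t\<close> the bound is -1, which only the zero polynomial
      meets.\<close>
    using degree_remainder_poly[of t t] by (simp add: degree_at_most_def)
  then show "remainder_poly t (Suc (t - 1)) = 0" using assms by simp
  show "coeffs_in_vars t (remainder_poly t s)" for s
    by (rule coeffs_in_vars_remainder_poly)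
  show "coeffs_in_vars t (remainder_poly t (Suc s))" for s
    by (rule coeffs_in_vars_remainder_poly)
  show "degree_at_most (remainder_poly t s) (int t - int s - 1)" if "s \<le> t" for s
    using that by (rule degree_remainder_poly)
  show "degree_at_most (remainder_poly t (Suc s)) (int t - int s - 2)" if "s \<le> t - 1" for s
    using degree_remainder_poly[of "Suc s" t] that assms by (simp add: algebra_simps)
next
  fix l :: "nat \<Rightarrow> nat" and n :: nat and T :: "nat set"
  assume n: "n > 2 * t + 1" and T: "T \<subseteq> {1..n-1}"
  let ?g = "sym_coeff (real n) (\<lambda>j. 4 * real (l j)) t"
  have F: "fourier_coeff (n - 1) (f_fun t l n) T = 1 / 2 ^ t * (?g (card T) + ?g (n - card T))"
    using fourier_coeff_f_fun[OF T, of t l] n by simp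
  have "fourier_coeff (n - 1) (f_fun t l n) T =
      (-1) ^ s / 2 ^ t * (fact t / fact (t-s)) * real n ^ (t-s)
      + poly (specialize l (remainder_poly t s)) (real n)"
    if s: "s \<le> t" "card T = s" for s
  proof -
    \<comment> \<open>The complement is too large to contribute.\<close>
    have "t < n - card T" using s n by linarith
    then have "?g (n - card T) = 0" by (rule sym_coeff_eq_0)
    then show ?thesis
      using s poly_specialize_remainder_poly[of s t n l] by (simp only: F add_0_right)
  qed
  moreover have "fourier_coeff (n - 1) (f_fun t l n) T =
      (-1) ^ (s+1) / 2 ^ t * (fact t / fact (t-s-1)) * real n ^ (t-1-s)
      + poly (specialize l (remainder_poly t (Suc s))) (real n)"
    if s: "s \<le> t - 1" "card T = n - 1 - s" for s
  proof -
    \<comment> \<open>Here \<open>T\<close> itself is too large, and only its complement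
      contributes.\<close>
    have "n - card T = Suc s" "t < card T" "Suc s \<le> t" using s n assms by linarith+
    moreover have "t - Suc s = t - s - 1" "t - Suc s = t - 1 - s" by simp_all
    ultimately show ?thesis
      using poly_specialize_remainder_poly[of "Suc s" t n l]
      by (simp only: F sym_coeff_eq_0[of t "card T"] add_0 Suc_eq_plus1)
  qed
  moreover have "fourier_coeff (n - 1) (f_fun t l n) T = 0"
    if "t < card T" "card T < n - 1 - t + 1"
  proof -
    \<comment> \<open>Since \<open>n - 1 - t + 1 = n - t\<close>, both \<open>T\<close> and its
      complement have more than \<open>t\<close> elements.\<close>
    have "t < n - card T" using that n by linarith
    then show ?thesis using that unfolding F by (simp add: sym_coeff_eq_0)
  qed
  ultimately show "let m = n - 1 in
        (\<forall>s\<le>t. card T = s \<longrightarrow>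
          fourier_coeff m (f_fun t l n) T =
            (-1) ^ s / 2 ^ t * (fact t / fact (t-s)) * real n ^ (t-s)
            + poly (specialize l (remainder_poly t s)) (real n)) \<and>
        (\<forall>s\<le>t-1. card T = m - s \<longrightarrow>
          fourier_coeff m (f_fun t l n) T =
            (-1) ^ (s+1) / 2 ^ t * (fact t / fact (t-s-1)) * real n ^ (t-1-s)
            + poly (specialize l (remainder_poly t (Suc s))) (real n)) \<and>
        (t < card T \<and> card T < m - t + 1 \<longrightarrow>
          fourier_coeff m (f_fun t l n) T = 0)"
    unfolding Let_def by blast
qed

end
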